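(* Let $(X,C)$ and $(Y,K)$ be Archimedean partially ordered vector spaces, $a\in X$, $b\in Y$, and let $f\colon [a,\infty)\to[b,\infty)$ be an order-isomorphism. Then $f$ is affine on $[a,\infty)_{\mathcal{R}_E}$, i.e. the restriction of $f$ to $[a,\infty)_{\mathcal{R}_E}$ is the restriction of an affine map defined on the affine span of $[a,\infty)_{\mathcal{R}_E}$.
   Context: A partially ordered vector space $(X,C)$ is a real vector space $X$ with a cone $C$ ($C$ convex, $\lambda C\subseteq C$ for $\lambda\ge 0$, $C\cap(-C)=\{0\}$), ordered by $x\le y$ iff $y-x\in C$. It is Archimedean if, whenever $x\in X$, $y\in C$ and $nx\le y$ for all integers $n\ge1$, then $x\le 0$. For $a\in X$, $[a,\infty)=\{a+x\colon x\in C\}$; for $b\in Y$, $[b,\infty)=\{b+y\colon y\in K\}$. An order-isomorphism is an order preserving bijection whose inverse is also order preserving. A vector $e\in C\setminus\{0\}$ is an extreme vector of $C$ if $0\le x\le e$ implies $x=\lambda e$ for some $\lambda\ge 0$; then $R_e=\{\lambda e\colon\lambda\ge0\}$ is an extreme ray. Let $\mathcal{R}$ be the collection of all extreme rays of $C$. A ray $R\in\mathcal{R}$ is engaged if $R\subseteq \mathrm{span}\{s\colon s\in S,\ S\in\mathcal{R}\setminus\{R\}\}$; $\mathcal{R}_E$ is the collection of engaged extreme rays, and an extreme vector $e\in C$ is engaged if $R_e\in\mathcal{R}_E$. Put $[a,\infty)_{\mathcal{R}_E}=\{a+r_1+\cdots+r_n\colon r_i\in C \text{ an engaged extreme vector for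 } i=1,\dots,n\}$. An affine map is a translate of a linear map. *)

theory Defs
  imports "HOL-Analysis.Analysis"
begin

text \<open>
  The library predicate \<^const>\<open>cone\<close> only expresses closure under nonnegative scaling;
  convexity and properness are added here. A partially ordered vector space is a type of
  class \<^class>\<open>real_vector\<close> together with such a set.
\<close>

definition proper_cone :: "'a::real_vector set \<Rightarrow> bool" where
  "proper_cone C \<longleftrightarrow> convex C \<and> cone C \<and> C \<inter> uminus ` C = {0}"

definition cone_le :: "'a::real_vector set \<Rightarrow> 'a \<Rightarrow> 'a \<Rightarrow> bool" where
  "cone_le C x y \<longleftrightarrow> y - x \<in> C"

definition archimedean_cone :: "'a::real_vector set \<Rightarrow> bool" where
  "archimedean_cone C \<longleftrightarrow>
     (\<forall>x. \<forall>y\<in>C. (\<forall>n::nat. 1 \<le> n \<longrightarrow> cone_le C (real n *\<^sub>R x) y) \<longrightarrow> cone_le C x 0)"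

definition archimedean_povs :: "'a::real_vector set \<Rightarrow> bool" where
  "archimedean_povs C \<longleftrightarrow> proper_cone C \<and> archimedean_cone C"

definition up_interval :: "'a::real_vector set \<Rightarrow> 'a \<Rightarrow> 'a set" where
  "up_interval C a = {a + x | x. x \<in> C}"

definition order_isomorphism ::
  "('a \<Rightarrow> 'a \<Rightarrow> bool) \<Rightarrow> 'a set \<Rightarrow> ('b \<Rightarrow> 'b \<Rightarrow> bool) \<Rightarrow> 'b set \<Rightarrow> ('a \<Rightarrow> 'b) \<Rightarrow> bool" where
  "order_isomorphism leA A leB B f \<longleftrightarrow>
     bij_betw f A B \<and> monotone_on A leA leB f \<and> monotone_on B leB leA (inv_into A f)"

definition extreme_vector :: "'a::real_vector set \<Rightarrow> 'a \<Rightarrow> bool" where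
  "extreme_vector C e \<longleftrightarrow> e \<in> C - {0} \<and>
     (\<forall>x. cone_le C 0 x \<and> cone_le C x e \<longrightarrow> (\<exists>l\<ge>0. x = l *\<^sub>R e))"

definition ray :: "'a::real_vector \<Rightarrow> 'a set" where
  "ray e = {l *\<^sub>R e | l. 0 \<le> l}"

definition extreme_rays :: "'a::real_vector set \<Rightarrow> 'a set set" where
  "extreme_rays C = {ray e | e. extreme_vector C e}"

definition engaged_rays :: "'a::real_vector set \<Rightarrow> 'a set set" where
  "engaged_rays C = {R \<in> extreme_rays C. R \<subseteq> span (\<Union>(extreme_rays C - {R}))}"

definition engaged_vector :: "'a::real_vector set \<Rightarrow> 'a \<Rightarrow> bool" where
  "engaged_vector C e \<longleftrightarrow> extreme_vector C e \<and> ray e \<in> engaged_rays C"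

text \<open>
  The empty sum is allowed, so \<open>a\<close> itself always belongs to this set.
\<close>

definition up_interval_engaged :: "'a::real_vector set \<Rightarrow> 'a \<Rightarrow> 'a set" where
  "up_interval_engaged C a =
     {a + (\<Sum>i=1..n. r i) | (n::nat) r. \<forall>i\<in>{1..n}. engaged_vector C (r i)}"

text \<open>
  An affine map is a translate of a linear map. The linear part is taken on the whole space:
  every linear map on the direction subspace of an affine set extends linearly.
\<close>

definition affine_map_on :: "'a::real_vector set \<Rightarrow> ('a \<Rightarrow> 'b::real_vector) \<Rightarrow> bool" where
  "affine_map_on A g \<longleftrightarrow> (\<exists>L c. linear L \<and> (\<forall>x\<in>A. g x = L x + c))"

definition restricts_affine :: "'a::real_vector set \<Rightarrow> ('a \<Rightarrow> 'b::real_vector) \<Rightarrow> bool" where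
  "restricts_affine S f \<longleftrightarrow> (\<exists>g. affine_map_on (affine hull S) g \<and> (\<forall>x\<in>S. f x = g x))"

end

theory Submission
  imports Defs
begin

text \<open>
  Extreme vectors are the \<open>e\<close> for which the order interval from 0 to \<open>e\<close> is a chain, so \<open>f\<close> maps
  half-lines \<open>x + ray r\<close> along extreme rays onto half-lines along extreme rays. Let \<open>r\<close> and \<open>s\<close> be
  extreme on different rays. Comparing \<open>f\<close> on \<open>x + ray r\<close> and \<open>x + s + ray r\<close>, the Archimedean
  property and extremality force the two image half-lines to be parallel and parametrised alike:
  the increment \<open>f (x + r) - f x\<close> does not change when \<open>x\<close> is shifted along \<open>s\<close>. If \<open>r\<close> is engaged,
  it is a combination of extreme vectors on other rays, so the increment is also unchanged by shifts
  along \<open>r\<close>. Then \<open>f\<close> satisfies Cauchy's equation on \<open>x + ray r\<close>, hence is affine there by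
  monotonicity, and the increments of the engaged vectors fit together to a linear map.
\<close>

section \<open>Extreme vectors of Archimedean cones\<close>

locale arch_cone =
  fixes C :: "'a::real_vector set"
  assumes arch_povs: "archimedean_povs C"
begin

lemma cone_add: "x \<in> C \<Longrightarrow> y \<in> C \<Longrightarrow> x + y \<in> C"
  using arch_povs convex_cone[of C] unfolding archimedean_povs_def proper_cone_def by blast

lemma cone_scale: "x \<in> C \<Longrightarrow> 0 \<le> l \<Longrightarrow> l *\<^sub>R x \<in> C"
  using arch_povs unfolding archimedean_povs_def proper_cone_def cone_def by blast

lemma cone_zero: "0 \<in> C"
  using arch_povs unfolding archimedean_povs_def proper_cone_def by blast

lemma cone_antisym: "x \<in> C \<Longrightarrow> - x \<in> C \<Longrightarrow> x = 0"
  using arch_povs unfolding archimedean_povs_def proper_cone_def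
  by (metis IntI add.inverse_inverse imageI singletonD)

lemma cone_archimedean:
  assumes "y \<in> C" and "\<And>n::nat. 1 \<le> n \<Longrightarrow> y - real n *\<^sub>R x \<in> C"
  shows "- x \<in> C"
  using arch_povs assms unfolding archimedean_povs_def archimedean_cone_def cone_le_def by auto

lemma cone_trans: "y - x \<in> C \<Longrightarrow> z - y \<in> C \<Longrightarrow> z - x \<in> C"
  using cone_add[of "y - x" "z - y"] by simp

lemma extreme_in_cone: "extreme_vector C e \<Longrightarrow> e \<in> C"
  and extreme_nonzero: "extreme_vector C e \<Longrightarrow> e \<noteq> 0"
  unfolding extreme_vector_def by auto

text \<open>Dividing by \<open>c\<close> reduces to the definition, which only covers vectors below
  \<open>e\<close> itself; for \<open>c = 0\<close> antisymmetry forces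
  \<open>x = 0\<close>.\<close>

lemma extreme_below:
  assumes "extreme_vector C e" "x \<in> C" "c *\<^sub>R e - x \<in> C" "0 \<le> c"
  obtains l where "0 \<le> l" "x = l *\<^sub>R e"
proof (cases "c = 0")
  case True
  then have "x = 0" using assms cone_antisym by auto
  then show ?thesis using that[of 0] by simp
next
  case False
  then have "c > 0" using assms by simp
  then have "inverse c *\<^sub>R x \<in> C" "inverse c *\<^sub>R (c *\<^sub>R e - x) \<in> C"
    using assms cone_scale by (auto simp del: scaleR_diff_right)
  then have "inverse c *\<^sub>R x \<in> C" "e - inverse c *\<^sub>R x \<in> C"
    using \<open>c > 0\<close> by (auto simp: scaleR_diff_right)
  then obtain l where "0 \<le> l" "inverse c *\<^sub>R x = l *\<^sub>R e"
    using assms(1) unfolding extreme_vector_def cone_le_def by auto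
  then have "x = (c * l) *\<^sub>R e"
    using \<open>c > 0\<close> by (metis False right_inverse scaleR_one scaleR_scaleR)
  then show ?thesis using that[of "c * l"] \<open>0 \<le> l\<close> \<open>c > 0\<close> by simp
qed

lemma extreme_scale:
  assumes "extreme_vector C e" "0 < c"
  shows "extreme_vector C (c *\<^sub>R e)"
  unfolding extreme_vector_def cone_le_def
proof (intro conjI allI impI)
  show "c *\<^sub>R e \<in> C - {0}"
    using assms cone_scale extreme_in_cone extreme_nonzero by auto
  fix x assume "x - 0 \<in> C \<and> c *\<^sub>R e - x \<in> C"
  then obtain l where l: "0 \<le> l" "x = l *\<^sub>R e"
    using extreme_below[OF assms(1), of x c] assms(2) by auto
  then show "\<exists>l\<ge>0. x = l *\<^sub>R c *\<^sub>R e"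
    using assms(2) by (intro exI[of _ "l / c"]) auto
qed

lemma scaled_le_iff:
  assumes "extreme_vector C e"
  shows "l *\<^sub>R e - m *\<^sub>R e \<in> C \<longleftrightarrow> m \<le> l"
proof
  show "m \<le> l \<Longrightarrow> l *\<^sub>R e - m *\<^sub>R e \<in> C"
    using cone_scale[of e "l - m"] extreme_in_cone[OF assms] by (simp add: scaleR_diff_left)
  assume *: "l *\<^sub>R e - m *\<^sub>R e \<in> C"
  show "m \<le> l"
  proof (rule ccontr)
    assume "\<not> m \<le> l"
    then have "(m - l) *\<^sub>R e \<in> C" "- ((m - l) *\<^sub>R e) \<in> C" "m - l \<noteq> 0"
      using cone_scale[of e "m - l"] extreme_in_cone[OF assms] * by (auto simp: scaleR_diff_left)
    then show False using cone_antisym extreme_nonzero[OF assms] by fastforce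
  qed
qed

text \<open>The factor is the supremum \<open>l\<close> of all \<open>t\<close> with
  \<open>t *\<^sub>R e\<close> below \<open>x\<close>. For \<open>t\<close> above \<open>l\<close>
  and at most 1, the chain condition puts \<open>x\<close> below \<open>t *\<^sub>R e\<close>. The
  Archimedean property lets \<open>t\<close> tend to \<open>l\<close> from both sides.\<close>

lemma extremeI_chain:
  assumes e: "e \<in> C" "e \<noteq> 0"
    and chain: "\<And>x y. x \<in> C \<Longrightarrow> y \<in> C \<Longrightarrow> e - x \<in> C \<Longrightarrow> e - y \<in> C \<Longrightarrow> y - x \<in> C \<or> x - y \<in> C"
  shows "extreme_vector C e"
  unfolding extreme_vector_def cone_le_def
proof (intro conjI allI impI)
  show "e \<in> C - {0}" using e by simp
  fix x assume "x - 0 \<in> C \<and> e - x \<in> C"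
  then have x: "x \<in> C" "e - x \<in> C" by auto
  define S where "S = {t. 0 \<le> t \<and> x - t *\<^sub>R e \<in> C}"
  define l where "l = Sup S"
  have le1: "t \<le> 1" if "t \<in> S" for t
  proof (rule ccontr)
    assume "\<not> t \<le> 1"
    moreover have "e - t *\<^sub>R e \<in> C" using cone_trans[of x "t *\<^sub>R e" e] that x unfolding S_def by auto
    then have "- ((t - 1) *\<^sub>R e) \<in> C" by (simp add: algebra_simps)
    ultimately have "(t - 1) *\<^sub>R e = 0"
      using cone_antisym[of "(t - 1) *\<^sub>R e"] cone_scale[of e "t - 1"] e by simp
    then show False using e \<open>\<not> t \<le> 1\<close> by simp
  qed
  have S0: "0 \<in> S" using x unfolding S_def by simp
  have bdd: "bdd_above S" by (rule bdd_aboveI) (rule le1)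
  have l01: "0 \<le> l" "l \<le> 1"
    unfolding l_def using cSup_upper[OF S0 bdd] cSup_least[of S 1] S0 le1 by auto
  have below: "x - t *\<^sub>R e \<in> C" if t: "t < l" for t
  proof -
    obtain u where u: "u \<in> S" "t < u" using less_cSupD[of S t] S0 t unfolding l_def by auto
    have "(x - u *\<^sub>R e) + (u - t) *\<^sub>R e \<in> C"
      using u e cone_add cone_scale unfolding S_def by auto
    then show ?thesis by (simp add: algebra_simps)
  qed
  have above: "t *\<^sub>R e - x \<in> C" if t: "l < t" for t
  proof (cases "t \<le> 1")
    case True
    have "t \<notin> S" using cSup_upper[OF _ bdd, of t] t unfolding l_def by auto
    then have "x - t *\<^sub>R e \<notin> C" using t l01 unfolding S_def by auto
    moreover have "e - t *\<^sub>R e \<in> C" using cone_scale[of e "1 - t"] e True by (simp add: algebra_simps)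
    ultimately show ?thesis
      using chain[of "t *\<^sub>R e" x] x cone_scale[of e t] e t l01 by auto
  next
    case False
    then have "(e - x) + (t - 1) *\<^sub>R e \<in> C" using x e cone_add cone_scale by auto
    then show ?thesis by (simp add: algebra_simps)
  qed
  have "- (l *\<^sub>R e - x) \<in> C"
  proof (rule cone_archimedean[OF e(1)])
    fix n :: nat assume n: "1 \<le> n"
    \<comment> \<open>Scaling the gap \<open>1 / n\<close> by \<open>n\<close> leaves exactly one
      copy of \<open>e\<close>, the fixed bound that \<open>cone_archimedean\<close> asks
      for.\<close>
    then have "real n *\<^sub>R (x - (l - 1 / n) *\<^sub>R e) \<in> C" using below[of "l - 1 / n"] cone_scale by auto
    then show "e - real n *\<^sub>R (l *\<^sub>R e - x) \<in> C" using n by (simp add: algebra_simps)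
  qed
  moreover have "- (x - l *\<^sub>R e) \<in> C"
  proof (rule cone_archimedean[OF e(1)])
    fix n :: nat assume n: "1 \<le> n"
    then have "real n *\<^sub>R ((l + 1 / n) *\<^sub>R e - x) \<in> C" using above[of "l + 1 / n"] cone_scale by auto
    then show "e - real n *\<^sub>R (x - l *\<^sub>R e) \<in> C" using n by (simp add: algebra_simps)
  qed
  ultimately have "x = l *\<^sub>R e" using cone_antisym[of "x - l *\<^sub>R e"] by simp
  then show "\<exists>l\<ge>0. x = l *\<^sub>R e" using l01 by blast
qed

end

section \<open>Rays, conic sums and Cauchy's functional equation\<close>

lemma mem_ray: "e \<in> ray e"
  unfolding ray_def by (auto intro: exI[of _ 1])

lemma ray_scale:
  assumes "0 < l"
  shows "ray (l *\<^sub>R e) = ray e"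
proof (intro equalityI subsetI)
  fix x assume "x \<in> ray (l *\<^sub>R e)"
  then obtain m where "0 \<le> m" "x = m *\<^sub>R l *\<^sub>R e" unfolding ray_def by auto
  then show "x \<in> ray e" using assms unfolding ray_def by (auto intro: exI[of _ "m * l"])
next
  fix x assume "x \<in> ray e"
  then obtain m where "0 \<le> m" "x = m *\<^sub>R e" unfolding ray_def by auto
  then show "x \<in> ray (l *\<^sub>R e)" using assms unfolding ray_def by (auto intro!: exI[of _ "m / l"])
qed

lemma ray_eqI:
  assumes "r = l *\<^sub>R s" "0 \<le> l" "r \<noteq> 0"
  shows "ray r = ray s"
  using assms ray_scale[of l s] by (cases "l = 0") auto

text \<open>Factors are strictly positive so that, when \<open>S\<close> consists of extreme
  vectors, every added summand is again extreme and induction applies one extreme shift at a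
  time.\<close>

inductive_set conic_sums :: "'a::real_vector set \<Rightarrow> 'a set" for S where
  zero: "0 \<in> conic_sums S"
| step: "u \<in> conic_sums S \<Longrightarrow> s \<in> S \<Longrightarrow> 0 < l \<Longrightarrow> u + l *\<^sub>R s \<in> conic_sums S"

lemma conic_sums_add:
  assumes "u \<in> conic_sums S" "v \<in> conic_sums S"
  shows "u + v \<in> conic_sums S"
  using assms(2)
proof induction
  case (step v s l)
  then show ?case using conic_sums.step[of "u + v" S s l] by (simp add: add.assoc)
qed (use assms(1) in simp)

text \<open>Terms with negative coefficient move to the left. The identity \<open>w + u = v\<close>
  has no subtraction, so for \<open>w\<close> and \<open>S\<close> inside a cone both sides can be
  walked without leaving an up-interval.\<close>

lemma span_conic_sums:
  assumes "w \<in> span S"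
  shows "\<exists>u\<in>conic_sums S. \<exists>v\<in>conic_sums S. w + u = v"
  using assms
proof (induction rule: span_induct_alt)
  case base
  then show ?case using conic_sums.zero by force
next
  case (step c s w)
  then obtain u v where uv: "u \<in> conic_sums S" "v \<in> conic_sums S" "w + u = v" by blast
  consider "c = 0" | "0 < c" | "c < 0" by linarith
  then show ?case
  proof cases
    case 1
    then show ?thesis using uv by auto
  next
    case 2
    then have "v + c *\<^sub>R s \<in> conic_sums S" using uv step(1) by (intro conic_sums.step)
    moreover have "c *\<^sub>R s + w + u = v + c *\<^sub>R s" using uv(3) by (simp add: algebra_simps)
    ultimately show ?thesis using uv(1) by blast
  next
    case 3
    then have "u + (- c) *\<^sub>R s \<in> conic_sums S" using uv step(1) by (intro conic_sums.step) auto
    moreover have "c *\<^sub>R s + w + (u + (- c) *\<^sub>R s) = v" using uv(3) by (simp add: algebra_simps)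
    ultimately show ?thesis using uv(2) by blast
  qed
qed

text \<open>Nonnegativity and additivity make \<open>p\<close> monotone. Squeezing
  \<open>n * x\<close> between consecutive integers bounds the distance from \<open>p x\<close> to
  \<open>x * p 1\<close> by \<open>p 1 / n\<close> for every positive \<open>n\<close>.\<close>

lemma nonneg_additive_linear:
  fixes p :: "real \<Rightarrow> real"
  assumes nonneg: "\<And>x. 0 \<le> x \<Longrightarrow> 0 \<le> p x"
    and add: "\<And>x y. 0 \<le> x \<Longrightarrow> 0 \<le> y \<Longrightarrow> p (x + y) = p x + p y"
    and x: "0 \<le> x"
  shows "p x = x * p 1"
proof -
  have p0: "p 0 = 0" using add[of 0 0] by simp
  have mult: "p (real n * y) = real n * p y" if "0 \<le> y" for n y
  proof (induction n)
    case (Suc n)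
    then show ?case using add[of y "real n * y"] that by (simp add: algebra_simps)
  qed (simp add: p0)
  have mono: "p y \<le> p z" if "0 \<le> y" "y \<le> z" for y z
    using add[of y "z - y"] nonneg[of "z - y"] that by simp
  have bound: "real n * \<bar>p x - x * p 1\<bar> \<le> p 1" for n
  proof -
    define k where "k = nat \<lfloor>real n * x\<rfloor>"
    have k: "real k \<le> real n * x" "real n * x \<le> real (Suc k)"
      unfolding k_def using x by (simp_all add: of_nat_nat) linarith
    have "real k * p 1 \<le> real n * p x" "real n * p x \<le> real (Suc k) * p 1"
      using mono[OF _ k(1)] mono[OF _ k(2)] mult[of 1 k] mult[of 1 "Suc k"] mult[OF x, of n] x by auto
    moreover have "real k * p 1 \<le> real n * x * p 1" "real n * x * p 1 \<le> real (Suc k) * p 1"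
      using k nonneg[of 1] by (auto intro: mult_right_mono simp del: of_nat_Suc)
    ultimately have "\<bar>real n * p x - real n * x * p 1\<bar> \<le> p 1" by (simp add: algebra_simps)
    moreover have "real n * p x - real n * x * p 1 = real n * (p x - x * p 1)"
      by (simp add: algebra_simps)
    ultimately show ?thesis by (simp add: abs_mult)
  qed
  have "\<bar>p x - x * p 1\<bar> = 0"
    by (rule real_archimedian_rdiv_eq_0[of _ "p 1"]) (use bound nonneg[of 1] in auto)
  then show ?thesis by simp
qed

section \<open>Images of extreme rays\<close>

text \<open>\<open>le_iff\<close> joins the monotonicity of \<open>f\<close> and of its inverse in
  one equivalence on differences, so the lemmas of this locale work without the inverse map.\<close>

locale cone_order_iso = dom: arch_cone C + cod: arch_cone K
  for C :: "'a::real_vector set" and K :: "'b::real_vector set" +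
  fixes a :: 'a and b :: 'b and f :: "'a \<Rightarrow> 'b"
  assumes bij: "bij_betw f (up_interval C a) (up_interval K b)"
    and le_iff: "x \<in> up_interval C a \<Longrightarrow> y \<in> up_interval C a \<Longrightarrow> f y - f x \<in> K \<longleftrightarrow> y - x \<in> C"
begin

abbreviation "A \<equiv> up_interval C a"

lemma mem_up: "x \<in> A \<longleftrightarrow> x - a \<in> C"
  unfolding up_interval_def by (auto intro: exI[of _ "x - a"])

lemma base_in: "a \<in> A"
  using mem_up dom.cone_zero by simp

lemma up_add: "x \<in> A \<Longrightarrow> c \<in> C \<Longrightarrow> x + c \<in> A"
  using mem_up dom.cone_add[of "x - a" c] by (simp add: algebra_simps)

lemma f_eq_iff: "x \<in> A \<Longrightarrow> y \<in> A \<Longrightarrow> f x = f y \<longleftrightarrow> x = y"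
  using bij unfolding bij_betw_def by (auto dest: inj_onD)

lemma f_onto:
  assumes "x \<in> A" "k \<in> K"
  obtains c where "c \<in> C" "f (x + c) = f x + k"
proof -
  have "f x - b \<in> K" using bij assms(1) unfolding bij_betw_def up_interval_def by force
  then have "f x + k \<in> up_interval K b"
    using cod.cone_add[of "f x - b" k] assms(2) unfolding up_interval_def
    by (auto intro!: exI[of _ "f x - b + k"])
  then obtain y where y: "y \<in> A" "f y = f x + k"
    using bij unfolding bij_betw_def by (metis imageE)
  then have "y - x \<in> C" using le_iff[of x y] assms by simp
  then show ?thesis using that[of "y - x"] y by simp
qed

lemma increment_le_iff:
  assumes "x \<in> A" "c \<in> C" "d \<in> C"
  shows "(f (x + d) - f x) - (f (x + c) - f x) \<in> K \<longleftrightarrow> d - c \<in> C"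
  using le_iff[of "x + c" "x + d"] up_add assms by simp

lemma increment_in:
  assumes "x \<in> A" "c \<in> C"
  shows "f (x + c) - f x \<in> K"
  using le_iff[of x "x + c"] up_add assms by simp

text \<open>By \<open>f_onto\<close>, a vector of \<open>K\<close> below this increment is the
  increment of some \<open>c\<close> below \<open>r\<close>, hence of a multiple of
  \<open>r\<close>. Such multiples are totally ordered, so the chain criterion applies.\<close>

lemma extreme_image:
  assumes "x \<in> A" "extreme_vector C r"
  shows "extreme_vector K (f (x + r) - f x)"
proof (rule cod.extremeI_chain)
  have r: "r \<in> C" "r \<noteq> 0" using assms dom.extreme_in_cone dom.extreme_nonzero by auto
  show "f (x + r) - f x \<in> K" using increment_in assms r by auto
  show "f (x + r) - f x \<noteq> 0" using f_eq_iff[of "x + r" x] up_add assms r by auto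
  have preimage: "\<exists>l\<ge>0. k = f (x + l *\<^sub>R r) - f x"
    if k: "k \<in> K" "f (x + r) - f x - k \<in> K" for k
  proof -
    obtain c where c: "c \<in> C" "f (x + c) = f x + k" using f_onto[OF assms(1) k(1)] .
    then have "r - c \<in> C" using increment_le_iff[of x c r] assms r k by simp
    then obtain l where "0 \<le> l" "c = l *\<^sub>R r"
      using dom.extreme_below[OF assms(2) c(1), of 1] by auto
    then show ?thesis using c by auto
  qed
  fix k h assume "k \<in> K" "h \<in> K" "f (x + r) - f x - k \<in> K" "f (x + r) - f x - h \<in> K"
  then obtain l m where lm: "0 \<le> l" "0 \<le> m" "k = f (x + l *\<^sub>R r) - f x" "h = f (x + m *\<^sub>R r) - f x"
    using preimage by metis
  then show "h - k \<in> K \<or> k - h \<in> K"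
    using increment_le_iff[of x "l *\<^sub>R r" "m *\<^sub>R r"] increment_le_iff[of x "m *\<^sub>R r" "l *\<^sub>R r"]
      dom.scaled_le_iff[OF assms(2)] dom.cone_scale[OF r(1)] assms(1) by (metis linear)
qed

text \<open>The chain criterion in the other direction; \<open>ray_onto\<close> uses it for
  preimages lying beyond \<open>r\<close>.\<close>

lemma extreme_preimage:
  assumes x: "x \<in> A" and y: "y \<in> C" and ext: "extreme_vector K (f (x + y) - f x)"
  shows "extreme_vector C y"
proof (rule dom.extremeI_chain[OF y])
  show "y \<noteq> 0" using cod.extreme_nonzero[OF ext] by auto
  have image: "\<exists>l\<ge>0. f (x + c) - f x = l *\<^sub>R (f (x + y) - f x)" if c: "c \<in> C" "y - c \<in> C" for c
    using cod.extreme_below[OF ext increment_in[OF x c(1)], of 1] increment_le_iff[OF x c(1) y] c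
    by (metis scaleR_one zero_le_one)
  fix c d assume cd: "c \<in> C" "d \<in> C" "y - c \<in> C" "y - d \<in> C"
  then obtain l m where "f (x + c) - f x = l *\<^sub>R (f (x + y) - f x)"
      "f (x + d) - f x = m *\<^sub>R (f (x + y) - f x)"
    using image by metis
  then show "d - c \<in> C \<or> c - d \<in> C"
    using increment_le_iff[OF x, of c d] increment_le_iff[OF x, of d c] cd
      cod.scaled_le_iff[OF ext] by (metis linear)
qed

lemma ray_image:
  assumes x: "x \<in> A" and r: "extreme_vector C r" and l: "0 \<le> l"
  obtains p where "0 \<le> p" "f (x + l *\<^sub>R r) - f x = p *\<^sub>R (f (x + r) - f x)"
proof -
  note rC = dom.extreme_in_cone[OF r]
  note ext = extreme_image[OF x r]
  show ?thesis
  proof (cases "l \<le> 1")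
    case True
    then have "r - l *\<^sub>R r \<in> C" using dom.scaled_le_iff[OF r, of 1 l] by simp
    then show ?thesis
      using that cod.extreme_below[OF ext increment_in[OF x dom.cone_scale[OF rC l]], of 1]
        increment_le_iff[OF x dom.cone_scale[OF rC l] rC] by auto
  next
    case False
    \<comment> \<open>Beyond \<open>r\<close> the roles swap: \<open>?e\<close> is itself extreme
      and dominates the increment along \<open>r\<close>, which is therefore a nonzero multiple of
      \<open>?e\<close>.\<close>
    let ?e = "f (x + l *\<^sub>R r) - f x"
    have lC: "l *\<^sub>R r \<in> C" using dom.cone_scale[OF rC l] .
    have ext': "extreme_vector K ?e"
      using extreme_image[OF x dom.extreme_scale[OF r, of l]] False by simp
    have "l *\<^sub>R r - r \<in> C" using dom.scaled_le_iff[OF r, of l 1] False by simp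
    then obtain q where q: "0 \<le> q" "f (x + r) - f x = q *\<^sub>R ?e"
      using cod.extreme_below[OF ext' increment_in[OF x rC], of 1] increment_le_iff[OF x rC lC] by auto
    moreover have "q \<noteq> 0" using q cod.extreme_nonzero[OF ext] by auto
    ultimately show ?thesis using that[of "1 / q"] by simp
  qed
qed

lemma ray_onto:
  assumes x: "x \<in> A" and r: "extreme_vector C r" and p: "0 \<le> p"
  obtains l where "0 \<le> l" "f (x + l *\<^sub>R r) - f x = p *\<^sub>R (f (x + r) - f x)"
proof -
  let ?e = "f (x + r) - f x"
  note rC = dom.extreme_in_cone[OF r]
  note ext = extreme_image[OF x r]
  have pe: "p *\<^sub>R ?e \<in> K" using cod.cone_scale[OF cod.extreme_in_cone[OF ext] p] .
  obtain c where c: "c \<in> C" "f (x + c) - f x = p *\<^sub>R ?e"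
    using f_onto[OF x pe] by (metis add_diff_cancel_left')
  obtain l where l: "0 \<le> l" "c = l *\<^sub>R r"
  proof (cases "p \<le> 1")
    case True
    then have "r - c \<in> C"
      using increment_le_iff[OF x c(1) rC] c(2) cod.scaled_le_iff[OF ext, of 1 p] by simp
    then show ?thesis using that dom.extreme_below[OF r c(1), of 1] by auto
  next
    case False
    \<comment> \<open>Here \<open>c\<close> is not below \<open>r\<close>. Instead \<open>c\<close>
      is extreme as the preimage of an extreme vector, and \<open>r\<close> below \<open>c\<close>
      forces both onto one ray.\<close>
    then have "extreme_vector C c"
      using extreme_preimage[OF x c(1)] c(2) cod.extreme_scale[OF ext, of p] by simp
    moreover have "c - r \<in> C"
      using increment_le_iff[OF x rC c(1)] c(2) cod.scaled_le_iff[OF ext, of p 1] False by simp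
    ultimately obtain q where q: "0 \<le> q" "r = q *\<^sub>R c"
      using dom.extreme_below[of c r 1] rC by auto
    moreover have "q \<noteq> 0" using q dom.extreme_nonzero[OF r] by auto
    ultimately show ?thesis using that[of "1 / q"] by simp
  qed
  then show ?thesis using that c by auto
qed

text \<open>Vectors on one extreme ray are comparable, so equal image rays would make
  \<open>r\<close> and \<open>s\<close> comparable; extremality of the larger puts the smaller on
  its ray.\<close>

lemma distinct_ray_images:
  assumes x: "x \<in> A" and r: "extreme_vector C r" and s: "extreme_vector C s"
    and ne: "ray r \<noteq> ray s"
  shows "ray (f (x + r) - f x) \<noteq> ray (f (x + s) - f x)"
proof
  let ?e = "f (x + s) - f x"
  note rC = dom.extreme_in_cone[OF r] and sC = dom.extreme_in_cone[OF s]
  note ext = extreme_image[OF x s]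
  assume "ray (f (x + r) - f x) = ray ?e"
  then have "f (x + r) - f x \<in> ray ?e" using mem_ray by metis
  then obtain l where l: "0 \<le> l" "f (x + r) - f x = l *\<^sub>R ?e" unfolding ray_def by auto
  show False
  proof (cases "l \<le> 1")
    case True
    then have "s - r \<in> C" using increment_le_iff[OF x rC sC] l cod.scaled_le_iff[OF ext, of 1 l] by simp
    then show False using dom.extreme_below[OF s rC, of 1] ray_eqI[of r _ s] dom.extreme_nonzero[OF r] ne
      by (metis scaleR_one zero_le_one)
  next
    case False
    then have "r - s \<in> C" using increment_le_iff[OF x sC rC] l cod.scaled_le_iff[OF ext, of l 1] by simp
    then show False using dom.extreme_below[OF r sC, of 1] ray_eqI[of s _ r] dom.extreme_nonzero[OF s] ne
      by (metis scaleR_one zero_le_one)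
  qed
qed

section \<open>Increments along different extreme rays\<close>

text \<open>The parameters \<open>mu\<close> and \<open>nu\<close> of the two image half-lines turn
  out to agree. The Archimedean property then puts \<open>r'\<close> below \<open>r''\<close>, so
  \<open>r'\<close> is \<open>m\<close> times \<open>r''\<close> with \<open>m \<le> 1\<close>, and
  \<open>m < 1\<close> contradicts \<open>no_bound\<close>.\<close>

lemma increment_shift:
  assumes x: "x \<in> A" and r: "extreme_vector C r" and s: "extreme_vector C s"
    and ne: "ray r \<noteq> ray s"
  shows "f (x + s + r) - f (x + s) = f (x + r) - f x"
proof -
  note rC = dom.extreme_in_cone[OF r] and sC = dom.extreme_in_cone[OF s]
  have xs: "x + s \<in> A" using up_add[OF x sC] .
  have xr: "x + l *\<^sub>R r \<in> A" if "0 \<le> l" for l using up_add[OF x dom.cone_scale[OF rC that]] .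
  define r' where "r' = f (x + r) - f x"
  define s' where "s' = f (x + s) - f x"
  define r'' where "r'' = f (x + s + r) - f (x + s)"
  \<comment> \<open>The increment along \<open>s\<close> seen from the moving point
    \<open>x + l *\<^sub>R r\<close>. Both are related to the fixed \<open>r'\<close>,
    \<open>r''\<close> and \<open>s'\<close> by \<open>t_eq\<close>.\<close>
  define t where "t l = f (x + l *\<^sub>R r + s) - f (x + l *\<^sub>R r)" for l
  have r'_ext: "extreme_vector K r'" unfolding r'_def using extreme_image[OF x r] .
  have r''_ext: "extreme_vector K r''" unfolding r''_def using extreme_image[OF xs r] .
  have s'K: "s' \<in> K" unfolding s'_def using increment_in[OF x sC] .
  have t_ext: "extreme_vector K (t l)" if "0 \<le> l" for l
    unfolding t_def using extreme_image[OF xr[OF that] s] .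
  have "\<forall>l. \<exists>p. 0 \<le> l \<longrightarrow> 0 \<le> p \<and> f (x + l *\<^sub>R r) - f x = p *\<^sub>R r'"
    unfolding r'_def using ray_image[OF x r] by metis
  then obtain mu where mu: "\<And>l. 0 \<le> l \<Longrightarrow> 0 \<le> mu l"
      "\<And>l. 0 \<le> l \<Longrightarrow> f (x + l *\<^sub>R r) - f x = mu l *\<^sub>R r'" by metis
  have "\<forall>l. \<exists>p. 0 \<le> l \<longrightarrow> 0 \<le> p \<and> f (x + s + l *\<^sub>R r) - f (x + s) = p *\<^sub>R r''"
    unfolding r''_def using ray_image[OF xs r] by metis
  then obtain nu where nu: "\<And>l. 0 \<le> l \<Longrightarrow> 0 \<le> nu l"
      "\<And>l. 0 \<le> l \<Longrightarrow> f (x + s + l *\<^sub>R r) - f (x + s) = nu l *\<^sub>R r''" by metis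
  have t_eq: "t l = s' + nu l *\<^sub>R r'' - mu l *\<^sub>R r'" if "0 \<le> l" for l
  proof -
    have "t l = s' + (f (x + s + l *\<^sub>R r) - f (x + s)) - (f (x + l *\<^sub>R r) - f x)"
      unfolding t_def s'_def by (simp add: algebra_simps)
    then show ?thesis using mu nu that by simp
  qed
  have mu_1: "mu 1 = 1"
  proof -
    have "mu 1 *\<^sub>R r' = 1 *\<^sub>R r'" using mu(2)[of 1] unfolding r'_def by simp
    then show ?thesis using cod.extreme_nonzero[OF r'_ext] scaleR_right_imp_eq by blast
  qed
  have nu_1: "nu 1 = 1"
  proof -
    have "nu 1 *\<^sub>R r'' = 1 *\<^sub>R r''" using nu(2)[of 1] unfolding r''_def by simp
    then show ?thesis using cod.extreme_nonzero[OF r''_ext] scaleR_right_imp_eq by blast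
  qed
  have nu_mono: "nu l \<le> nu k" if "0 \<le> l" "l \<le> k" for l k
    using increment_le_iff[OF xs dom.cone_scale[OF rC, of l] dom.cone_scale[OF rC, of k]]
      that nu(2)[of l] nu(2)[of k] cod.scaled_le_iff[OF r''_ext] dom.scaled_le_iff[OF r] by simp
  \<comment> \<open>The increment along \<open>r\<close> at \<open>x + l *\<^sub>R r\<close> is a
    positive multiple of \<open>r'\<close>, so otherwise \<open>r\<close> and \<open>s\<close> would
    have the same image ray at that point.\<close>
  have not_parallel: "r' \<noteq> m *\<^sub>R t l" if l: "0 \<le> l" and m: "0 \<le> m" for l m
  proof
    assume "r' = m *\<^sub>R t l"
    then have eq: "ray r' = ray (t l)" using ray_eqI m cod.extreme_nonzero[OF r'_ext] by blast
    let ?e = "f (x + l *\<^sub>R r + r) - f (x + l *\<^sub>R r)"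
    have e_ext: "extreme_vector K ?e" using extreme_image[OF xr[OF l] r] .
    have e_eq: "?e = mu (l + 1) *\<^sub>R r' - mu l *\<^sub>R r'"
      using mu(2)[of "l + 1"] mu(2)[of l] l by (simp add: algebra_simps)
    then have "mu l \<le> mu (l + 1)"
      using cod.extreme_in_cone[OF e_ext] cod.scaled_le_iff[OF r'_ext] by simp
    moreover have "?e = (mu (l + 1) - mu l) *\<^sub>R r'" using e_eq by (simp add: scaleR_diff_left)
    ultimately have "ray ?e = ray r'" using ray_eqI[of ?e] cod.extreme_nonzero[OF e_ext] by simp
    then show False using distinct_ray_images[OF xr[OF l] r s ne] eq unfolding t_def by simp
  qed
  have no_bound: "c *\<^sub>R t l - d *\<^sub>R r' \<notin> K" if l: "0 \<le> l" and c: "0 \<le> c" and d: "0 < d" for l c d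
  proof
    assume "c *\<^sub>R t l - d *\<^sub>R r' \<in> K"
    moreover have "d *\<^sub>R r' \<in> K" using cod.cone_scale cod.extreme_in_cone[OF r'_ext] d by simp
    ultimately obtain m where m: "0 \<le> m" "d *\<^sub>R r' = m *\<^sub>R t l"
      using cod.extreme_below[OF t_ext[OF l] _ _ c] by metis
    then have "r' = (m / d) *\<^sub>R t l" using d
      by (metis divide_inverse_commute less_numeral_extra(3) left_inverse scaleR_one scaleR_scaleR)
    then show False using not_parallel[OF l, of "m / d"] m d by simp
  qed
  \<comment> \<open>Far out on the image of the ray through \<open>s\<close>, the contribution of \<open>r'\<close> becomes negligible.\<close>
  have s'_bound: "\<exists>c\<ge>0. c *\<^sub>R t l + eps *\<^sub>R r' - s' \<in> K" if l: "0 \<le> l" and eps: "0 < eps" for l eps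
  proof -
    \<comment> \<open>With this choice, dividing by \<open>q\<close> shrinks the coefficient
      \<open>mu l\<close> of \<open>r'\<close> to at most \<open>eps\<close>.\<close>
    define q where "q = (mu l + 1) / eps"
    have q: "0 < q" "mu l \<le> q * eps" using mu(1)[OF l] eps unfolding q_def by auto
    obtain k where k: "0 \<le> k" "f (x + k *\<^sub>R s) - f x = q *\<^sub>R s'"
      unfolding s'_def using ray_onto[OF x s, of q] q by auto
    obtain u where u: "0 \<le> u" "f (x + l *\<^sub>R r + k *\<^sub>R s) - f (x + l *\<^sub>R r) = u *\<^sub>R t l"
      unfolding t_def using ray_image[OF xr[OF l] s k(1)] .
    have "x + k *\<^sub>R s \<in> A" using up_add[OF x dom.cone_scale[OF sC k(1)]] .
    then have "f (x + k *\<^sub>R s + l *\<^sub>R r) - f (x + k *\<^sub>R s) \<in> K"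
      using increment_in dom.cone_scale[OF rC l] by blast
    \<comment> \<open>Going round the parallelogram spanned at \<open>x\<close> by
      \<open>l *\<^sub>R r\<close> and \<open>k *\<^sub>R s\<close> expresses this side by the other
      three.\<close>
    also have "f (x + k *\<^sub>R s + l *\<^sub>R r) - f (x + k *\<^sub>R s) =
        (f (x + l *\<^sub>R r + k *\<^sub>R s) - f (x + l *\<^sub>R r)) + (f (x + l *\<^sub>R r) - f x) - (f (x + k *\<^sub>R s) - f x)"
      by (simp add: algebra_simps)
    finally have "u *\<^sub>R t l + mu l *\<^sub>R r' - q *\<^sub>R s' \<in> K"
      using u(2) k(2) mu(2)[OF l] by simp
    moreover have "(q * eps - mu l) *\<^sub>R r' \<in> K"
      using cod.cone_scale[OF cod.extreme_in_cone[OF r'_ext]] q by simp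
    ultimately have "(1 / q) *\<^sub>R ((u *\<^sub>R t l + mu l *\<^sub>R r' - q *\<^sub>R s') + (q * eps - mu l) *\<^sub>R r') \<in> K"
      using cod.cone_add cod.cone_scale q by simp
    also have "(1 / q) *\<^sub>R ((u *\<^sub>R t l + mu l *\<^sub>R r' - q *\<^sub>R s') + (q * eps - mu l) *\<^sub>R r') =
        (u / q) *\<^sub>R t l + eps *\<^sub>R r' - s'"
      using q by (simp add: algebra_simps)
    finally show ?thesis using u q by (intro exI[of _ "u / q"]) auto
  qed
  have proportional: "nu k * mu l = nu l * mu k" if l: "0 \<le> l" and lk: "l \<le> k" for l k
  proof -
    have k: "0 \<le> k" using l lk by simp
    \<comment> \<open>\<open>rel\<close> below eliminates \<open>r''\<close> from the formulas for
      \<open>t l\<close> and \<open>t k\<close>; \<open>B\<close> is the coefficient left on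
      \<open>r'\<close>, to be shown zero.\<close>
    define B where "B = nu k * mu l - nu l * mu k"
    define d where "d = nu k - nu l"
    have d: "0 \<le> d" using nu_mono[OF l lk] unfolding d_def by simp
    have rel: "nu k *\<^sub>R t l + B *\<^sub>R r' = nu l *\<^sub>R t k + d *\<^sub>R s'"
      unfolding t_eq[OF l] t_eq[OF k] B_def d_def by (simp add: algebra_simps)
    have "\<not> 0 < B"
    proof
      assume B: "0 < B"
      \<comment> \<open>Small enough that bounding \<open>d\<close> copies of \<open>s'\<close> by
        \<open>s'_bound\<close> leaves the positive coefficient \<open>B - d * eps\<close> on
        \<open>r'\<close>; the \<open>+ 1\<close> covers \<open>d = 0\<close>.\<close>
      define eps where "eps = B / (2 * (d + 1))"
      have eps: "0 < eps" "d * eps < B" using B d unfolding eps_def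
        by (auto simp: divide_simps)
      obtain c where c: "0 \<le> c" "c *\<^sub>R t k + eps *\<^sub>R r' - s' \<in> K"
        using s'_bound[OF k eps(1)] by blast
      have "nu k *\<^sub>R t l + d *\<^sub>R (c *\<^sub>R t k + eps *\<^sub>R r' - s') \<in> K"
        using cod.cone_add cod.cone_scale c d nu(1)[OF k] cod.extreme_in_cone[OF t_ext[OF l]] by simp
      also have "nu k *\<^sub>R t l + d *\<^sub>R (c *\<^sub>R t k + eps *\<^sub>R r' - s') =
          (nu k *\<^sub>R t l + B *\<^sub>R r') - B *\<^sub>R r' + d *\<^sub>R (c *\<^sub>R t k + eps *\<^sub>R r' - s')"
        by simp
      also have "\<dots> = (nu l + d * c) *\<^sub>R t k - (B - d * eps) *\<^sub>R r'"
        unfolding rel by (simp add: algebra_simps)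
      finally show False using no_bound[OF k, of "nu l + d * c" "B - d * eps"] nu(1)[OF l] c d eps by simp
    qed
    moreover have "\<not> B < 0"
    proof
      assume B: "B < 0"
      have "nu l *\<^sub>R t k + d *\<^sub>R s' \<in> K"
        using cod.cone_add cod.cone_scale d s'K nu(1)[OF l] cod.extreme_in_cone[OF t_ext[OF k]] by simp
      then have "nu k *\<^sub>R t l - (- B) *\<^sub>R r' \<in> K" unfolding rel[symmetric] by simp
      then show False using no_bound[OF l nu(1)[OF k], of "- B"] B by (metis neg_0_less_iff_less)
    qed
    ultimately show ?thesis unfolding B_def by simp
  qed
  have nu_eq: "nu l = mu l" if "0 \<le> l" for l
    using proportional[of l 1] proportional[of 1 l] that mu_1 nu_1 by (cases "l \<le> 1") auto
  have "- (r' - r'') \<in> K"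
  proof (rule cod.cone_archimedean[OF s'K])
    fix n :: nat
    \<comment> \<open>At this \<open>l\<close> both \<open>mu l\<close> and \<open>nu l\<close>
      equal \<open>n\<close>, so subtracting \<open>n\<close> copies of \<open>r' - r''\<close> from
      \<open>s'\<close> gives \<open>t l\<close>, which lies in \<open>K\<close>.\<close>
    obtain l where l: "0 \<le> l" "f (x + l *\<^sub>R r) - f x = real n *\<^sub>R r'"
      unfolding r'_def using ray_onto[OF x r, of "real n"] by auto
    then have "mu l = real n" using mu(2)[of l] cod.extreme_nonzero[OF r'_ext] by simp
    then have "s' - real n *\<^sub>R (r' - r'') = t l"
      using t_eq[OF l(1)] nu_eq[OF l(1)] by (simp add: algebra_simps)
    then show "s' - real n *\<^sub>R (r' - r'') \<in> K"
      using cod.extreme_in_cone[OF t_ext[OF l(1)]] by simp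
  qed
  then have le: "r'' - r' \<in> K" by simp
  obtain m where m: "0 \<le> m" "r' = m *\<^sub>R r''"
    using cod.extreme_below[OF r''_ext cod.extreme_in_cone[OF r'_ext], of 1] le by auto
  have "1 *\<^sub>R r'' - m *\<^sub>R r'' \<in> K" using le m by simp
  then have "m \<le> 1" using cod.scaled_le_iff[OF r''_ext] by blast
  moreover have "\<not> m < 1"
  proof
    assume "m < 1"
    \<comment> \<open>Scaling by \<open>m\<close> turns the \<open>r''\<close> in \<open>t 1\<close>
      into a full \<open>r'\<close>, which exceeds the subtracted
      \<open>m *\<^sub>R r'\<close>.\<close>
    have "m *\<^sub>R t 1 - (1 - m) *\<^sub>R r' = m *\<^sub>R s'"
      unfolding t_eq[OF zero_le_one] mu_1 nu_1 using m(2) by (simp add: algebra_simps)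
    then show False using no_bound[of 1 m "1 - m"] cod.cone_scale[OF s'K m(1)] m \<open>m < 1\<close> by simp
  qed
  ultimately show ?thesis using m unfolding r'_def r''_def by simp
qed

section \<open>Engaged extreme vectors\<close>

lemma engaged_extreme: "engaged_vector C r \<Longrightarrow> extreme_vector C r"
  unfolding engaged_vector_def by simp

lemma engaged_scale: "engaged_vector C r \<Longrightarrow> 0 < l \<Longrightarrow> engaged_vector C (l *\<^sub>R r)"
  unfolding engaged_vector_def using dom.extreme_scale ray_scale[of l r] by metis

lemma conic_sums_subset_cone:
  assumes "u \<in> conic_sums S" "S \<subseteq> C"
  shows "u \<in> C"
  using assms by induction (auto intro!: dom.cone_zero dom.cone_add dom.cone_scale)

lemma increment_shift_conic_sums:
  assumes "u \<in> conic_sums S" and x: "x \<in> A" and S: "S \<subseteq> C"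
    and shift: "\<And>x s l. x \<in> A \<Longrightarrow> s \<in> S \<Longrightarrow> 0 < l \<Longrightarrow>
      f (x + l *\<^sub>R s + r) - f (x + l *\<^sub>R s) = f (x + r) - f x"
  shows "f (x + u + r) - f (x + u) = f (x + r) - f x"
  using assms(1)
proof induction
  case (step u s l)
  have "x + u \<in> A" using up_add[OF x] conic_sums_subset_cone[OF step(1) S] .
  then show ?case using shift[of "x + u" s l] step by (simp add: add.assoc)
qed simp

text \<open>On a common ray, engagedness gives \<open>e + u = v\<close> with \<open>u\<close> and
  \<open>v\<close> conic sums of extreme vectors off that ray. The point \<open>x + v\<close> is
  then reached from \<open>x + e\<close> along \<open>u\<close> and from \<open>x\<close> along
  \<open>v\<close>, neither changing the increment.\<close>

lemma increment_shift_engaged: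
  assumes x: "x \<in> A" and r: "engaged_vector C r" and e: "extreme_vector C e"
  shows "f (x + e + r) - f (x + e) = f (x + r) - f x"
proof (cases "ray r = ray e")
  case False
  then show ?thesis using increment_shift[OF x engaged_extreme[OF r] e] by simp
next
  case True
  define S where "S = {s. extreme_vector C s \<and> ray r \<noteq> ray s}"
  have S: "S \<subseteq> C" unfolding S_def using dom.extreme_in_cone by auto
  have "\<Union>(extreme_rays C - {ray r}) \<subseteq> span S"
  proof
    fix y assume "y \<in> \<Union>(extreme_rays C - {ray r})"
    then obtain s where s: "s \<in> S" "y \<in> ray s" unfolding extreme_rays_def S_def by blast
    then obtain l where "y = l *\<^sub>R s" unfolding ray_def by blast
    then show "y \<in> span S" using span_base[OF s(1)] span_scale by blast
  qed
  then have "span (\<Union>(extreme_rays C - {ray r})) \<subseteq> span S" by (rule span_minimal) simp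
  moreover have "e \<in> ray r" using True mem_ray by metis
  ultimately have "e \<in> span S" using r unfolding engaged_vector_def engaged_rays_def by auto
  then obtain u v where uv: "u \<in> conic_sums S" "v \<in> conic_sums S" "e + u = v"
    using span_conic_sums by blast
  have shift: "f (x + l *\<^sub>R s + r) - f (x + l *\<^sub>R s) = f (x + r) - f x"
    if "x \<in> A" "s \<in> S" "0 < l" for x s l
    using that increment_shift[OF _ engaged_extreme[OF r] dom.extreme_scale[of s l]] ray_scale[of l s]
    unfolding S_def by simp
  have xe: "x + e \<in> A" using up_add[OF x dom.extreme_in_cone[OF e]] .
  have "f (x + e + r) - f (x + e) = f (x + e + u + r) - f (x + e + u)"
    using increment_shift_conic_sums[OF uv(1) xe S shift] by simp
  also have "\<dots> = f (x + v + r) - f (x + v)" using uv(3) by (simp add: add.assoc)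
  also have "\<dots> = f (x + r) - f x" using increment_shift_conic_sums[OF uv(2) x S shift] by simp
  finally show ?thesis .
qed

text \<open>Moving the base point along \<open>r\<close> itself leaves increments along
  \<open>r\<close> unchanged, so the coefficient \<open>p\<close> solves Cauchy's equation on the
  half-line.\<close>

lemma increment_scale_engaged:
  assumes x: "x \<in> A" and r: "engaged_vector C r" and l: "0 \<le> l"
  shows "f (x + l *\<^sub>R r) - f x = l *\<^sub>R (f (x + r) - f x)"
proof -
  let ?r = "f (x + r) - f x"
  have ext: "extreme_vector C r" using engaged_extreme[OF r] .
  have ne: "?r \<noteq> 0" using cod.extreme_nonzero[OF extreme_image[OF x ext]] .
  have "\<forall>l. \<exists>p. 0 \<le> l \<longrightarrow> 0 \<le> p \<and> f (x + l *\<^sub>R r) - f x = p *\<^sub>R ?r"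
    using ray_image[OF x ext] by metis
  then obtain p where p: "\<And>l. 0 \<le> l \<Longrightarrow> 0 \<le> p l"
      "\<And>l. 0 \<le> l \<Longrightarrow> f (x + l *\<^sub>R r) - f x = p l *\<^sub>R ?r" by metis
  have p0: "p 0 = 0" using p(2)[of 0] ne by simp
  have p1: "p 1 = 1" using p(2)[of 1] ne scaleR_right_imp_eq[of ?r "p 1" 1] by simp
  have additive: "p (l + m) = p l + p m" if lm: "0 \<le> l" "0 \<le> m" for l m
  proof (cases "l = 0 \<or> m = 0")
    case True
    then show ?thesis using p0 by auto
  next
    case False
    then have "f (x + l *\<^sub>R r + m *\<^sub>R r) - f (x + l *\<^sub>R r) = f (x + m *\<^sub>R r) - f x"
      using increment_shift_engaged[OF x engaged_scale[OF r] dom.extreme_scale[OF ext]] lm by simp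
    then have "f (x + (l + m) *\<^sub>R r) - f x = (f (x + l *\<^sub>R r) - f x) + (f (x + m *\<^sub>R r) - f x)"
      by (simp add: algebra_simps)
    then have "p (l + m) *\<^sub>R ?r = p l *\<^sub>R ?r + p m *\<^sub>R ?r"
      using p(2)[of l] p(2)[of m] p(2)[of "l + m"] lm by simp
    then show ?thesis using ne scaleR_right_imp_eq[of ?r "p (l + m)" "p l + p m"]
      by (simp add: scaleR_add_left)
  qed
  have "p l = l" using nonneg_additive_linear[of p l] p(1) additive l p1 by simp
  then show ?thesis using p(2)[OF l] by simp
qed

text \<open>Increments from \<open>a\<close> are additive on conic sums of engaged vectors.
  \<open>L\<close> is prescribed on a basis chosen among these vectors, where it can be matched with
  \<open>f\<close>.\<close>

lemma linear_on_engaged_sums: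
  obtains L where "linear L"
    "\<And>u. u \<in> conic_sums {r. engaged_vector C r} \<Longrightarrow> f (a + u) - f a = L u"
proof -
  define G where "G = {r. engaged_vector C r}"
  define T where "T u = f (a + u) - f a" for u
  have G: "G \<subseteq> C" unfolding G_def using dom.extreme_in_cone[OF engaged_extreme] by auto
  have T0: "T 0 = 0" unfolding T_def by simp
  have T_step: "T (u + l *\<^sub>R r) = T u + l *\<^sub>R T r" if "u \<in> conic_sums G" "r \<in> G" "0 < l" for u l r
  proof -
    have lr: "engaged_vector C (l *\<^sub>R r)" using that engaged_scale unfolding G_def by simp
    have "f (a + u + l *\<^sub>R r) - f (a + u) = f (a + l *\<^sub>R r) - f a"
    proof (rule increment_shift_conic_sums[OF that(1) base_in G])
      fix x s k assume "x \<in> A" "s \<in> G" "0 < (k::real)"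
      then show "f (x + k *\<^sub>R s + l *\<^sub>R r) - f (x + k *\<^sub>R s) = f (x + l *\<^sub>R r) - f x"
        using increment_shift_engaged[OF _ lr engaged_extreme[OF engaged_scale]] unfolding G_def by simp
    qed
    also have "\<dots> = l *\<^sub>R T r"
      using increment_scale_engaged[OF base_in, of r l] that unfolding G_def T_def by simp
    finally show ?thesis unfolding T_def by (simp add: algebra_simps)
  qed
  have T_add: "T (u + v) = T u + T v" if "u \<in> conic_sums G" "v \<in> conic_sums G" for u v
    using that(2)
  proof induction
    case (step v r l)
    then have "u + v \<in> conic_sums G" using conic_sums_add that(1) by blast
    then show ?case using T_step[of "u + v" r l] T_step[of v r l] step by (simp add: add.assoc)
  qed (simp add: T0)
  obtain B where B: "B \<subseteq> G" "independent B" "G \<subseteq> span B"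
    using maximal_independent_subset by blast
  obtain L where L: "linear L" "\<forall>r\<in>B. L r = T r"
    using linear_independent_extend[OF B(2)] by blast
  have TL: "u \<in> conic_sums G \<and> T u = L u" if "u \<in> conic_sums B" for u
    using that
  proof induction
    case (step u r l)
    then show ?case using T_step[of u r l] B(1) L conic_sums.step[of u G r l]
      by (auto simp: linear_add linear_scale)
  qed (simp add: T0 linear_0[OF L(1)] conic_sums.zero)
  have "T w = L w" if w: "w \<in> conic_sums G" for w
  proof -
    have "w \<in> span B" using w
    proof induction
      case (step u r l)
      then show ?case using B(3) by (auto intro: span_add span_scale)
    qed (simp add: span_zero)
    \<comment> \<open>Expanding \<open>w\<close> in the basis may need negative coefficients; moving
      them across lets additivity of \<open>T\<close> apply, and \<open>T u = L u\<close>
      cancels.\<close>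
    then obtain u v where uv: "u \<in> conic_sums B" "v \<in> conic_sums B" "w + u = v"
      using span_conic_sums by blast
    then have "T w + T u = L w + L u"
      using T_add[OF w, of u] TL[of u] TL[of v] linear_add[OF L(1), of w u] by simp
    then show ?thesis using TL uv(1) by simp
  qed
  then show ?thesis using that[of L] L(1) unfolding T_def G_def by blast
qed

end

section \<open>Assembly of the affine map\<close>

lemma sum_in_conic_sums:
  assumes "\<forall>i\<in>{1..n::nat}. r i \<in> S"
  shows "(\<Sum>i=1..n. r i) \<in> conic_sums S"
  using assms
proof (induction n)
  case (Suc n)
  then have "(\<Sum>i=1..n. r i) + 1 *\<^sub>R r (Suc n) \<in> conic_sums S"
    by (intro conic_sums.step) auto
  then show ?case by simp
qed (simp add: conic_sums.zero)

theorem theorem3p10: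
  fixes C :: "'a::real_vector set" and K :: "'b::real_vector set"
    and a :: 'a and b :: 'b and f :: "'a \<Rightarrow> 'b"
  assumes "archimedean_povs C" and "archimedean_povs K"
    and "order_isomorphism (cone_le C) (up_interval C a) (cone_le K) (up_interval K b) f"
  shows "restricts_affine (up_interval_engaged C a) f"
proof -
  let ?A = "up_interval C a" and ?B = "up_interval K b"
  have bij: "bij_betw f ?A ?B"
    and mono: "monotone_on ?A (cone_le C) (cone_le K) f"
    and mono_inv: "monotone_on ?B (cone_le K) (cone_le C) (inv_into ?A f)"
    using assms(3) unfolding order_isomorphism_def by auto
  interpret cone_order_iso C K a b f
  proof unfold_locales
    show "archimedean_povs C" "archimedean_povs K" "bij_betw f ?A ?B" by fact+
    fix x y assume xy: "x \<in> ?A" "y \<in> ?A"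
    then have "f x \<in> ?B" "f y \<in> ?B" "inv_into ?A f (f x) = x" "inv_into ?A f (f y) = y"
      using bij unfolding bij_betw_def by (auto simp: inv_into_f_f)
    then show "f y - f x \<in> K \<longleftrightarrow> y - x \<in> C"
      using monotone_onD[OF mono xy] monotone_onD[OF mono_inv, of "f x" "f y"]
      unfolding cone_le_def by auto
  qed
  obtain L where L: "linear L"
    "\<And>u. u \<in> conic_sums {r. engaged_vector C r} \<Longrightarrow> f (a + u) - f a = L u"
    using linear_on_engaged_sums by blast
  let ?g = "\<lambda>x. L x + (f a - L a)"
  have "f x = ?g x" if "x \<in> up_interval_engaged C a" for x
  proof -
    obtain n r where x: "x = a + (\<Sum>i=1..n::nat. r i)" "\<forall>i\<in>{1..n}. engaged_vector C (r i)"
      using \<open>x \<in> up_interval_engaged C a\<close> unfolding up_interval_engaged_def by blast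
    then have "f x - f a = L (\<Sum>i=1..n. r i)"
      using L(2) sum_in_conic_sums[of n r "{r. engaged_vector C r}"] by simp
    then show ?thesis using x(1) linear_add[OF L(1)] by (simp add: algebra_simps)
  qed
  moreover have "affine_map_on (affine hull up_interval_engaged C a) ?g"
    unfolding affine_map_on_def using L(1) by blast
  ultimately show ?thesis unfolding restricts_affine_def by blast
qed

end
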